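(* For almost surely bounded random variables $X$, symmetry of $X$ is neither (i) a sufficient condition, nor (ii) a necessary condition, for strict sub-Gaussianity. That is: (i) there exists an almost surely bounded random variable that is symmetric but not strictly sub-Gaussian; and (ii) there exists an almost surely bounded random variable that is strictly sub-Gaussian but not symmetric.
   Context: A random variable $X$ with finite mean $\mu=\mathbb{E}[X]$ is called $\sigma^2$-sub-Gaussian, with proxy variance $\sigma^2>0$, if $\mathbb{E}[\exp(\lambda(X-\mu))]\le \exp(\lambda^2\sigma^2/2)$ for all $\lambda\in\mathbb{R}$. The smallest such $\sigma^2$ is the optimal proxy variance $\sigma_{\mathrm{opt}}^2(X)$. One says that $X$ is strictly sub-Gaussian if $\sigma_{\mathrm{opt}}^2(X)=\mathbb{V}[X]$, where $\mathbb{V}[X]$ is the variance of $X$. One says that $X$ is symmetric if $X$ and $2\mu-X$ have the same distribution. Random variables are assumed non-degenerate (not almost surely constant). *)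

theory Defs
  imports "HOL-Probability.Probability"
begin

context prob_space
begin

definition as_bounded :: "('a \<Rightarrow> real) \<Rightarrow> bool" where
  "as_bounded X \<longleftrightarrow> (\<exists>B. AE x in M. \<bar>X x\<bar> \<le> B)"

definition nondegenerate :: "('a \<Rightarrow> real) \<Rightarrow> bool" where
  "nondegenerate X \<longleftrightarrow> \<not> (\<exists>c. AE x in M. X x = c)"

definition symmetric_rv :: "('a \<Rightarrow> real) \<Rightarrow> bool" where
  "symmetric_rv X \<longleftrightarrow> distr M borel X = distr M borel (\<lambda>x. 2 * expectation X - X x)"

text \<open>The parameter \<open>s\<close> is the proxy variance itself (the square of \<open>\<sigma>\<close>).
  Integrability of the exponential is required explicitly, since the Bochner integral
  of a non-integrable function is \<open>0\<close>.\<close>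

definition sub_gaussian :: "('a \<Rightarrow> real) \<Rightarrow> real \<Rightarrow> bool" where
  "sub_gaussian X s \<longleftrightarrow> integrable M X \<and> s > 0 \<and>
     (\<forall>l::real. integrable M (\<lambda>x. exp (l * (X x - expectation X))) \<and>
        expectation (\<lambda>x. exp (l * (X x - expectation X))) \<le> exp (l\<^sup>2 * s / 2))"

text \<open>Meaningful only if \<open>X\<close> is non-degenerate and sub-Gaussian for some proxy variance;
  then the minimum exists.\<close>

definition optimal_proxy_variance :: "('a \<Rightarrow> real) \<Rightarrow> real" where
  "optimal_proxy_variance X = (LEAST s. sub_gaussian X s)"

definition strictly_sub_gaussian :: "('a \<Rightarrow> real) \<Rightarrow> bool" where
  "strictly_sub_gaussian X \<longleftrightarrow>
     (\<exists>s. sub_gaussian X s) \<and> optimal_proxy_variance X = variance X"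

end

end

theory Submission
  imports Defs
begin

text \<open>
  For a non-degenerate variable the set of proxy variances is closed under infima and bounded
  below by the variance: closed, because for each \<open>l\<close> the bound on the moment generating function
  is a closed condition on \<open>s\<close>; bounded below, because comparing the expansions
  \<open>1 + l\<^sup>2 Var X / 2\<close> and \<open>1 + l\<^sup>2 s / 2\<close> at \<open>l \<rightarrow> 0\<close> gives \<open>Var X \<le> s\<close>. Hence strict
  sub-Gaussianity just says that the variance itself is a proxy variance
  (\<open>strictly_sub_gaussian_iff\<close>), and both halves of the theorem become questions about one
  explicit inequality for a law with three atoms.

  For the first half, a symmetric law with most of its mass at the centre has tails that are too
  heavy for its variance. The masses \<open>1/16, 7/8, 1/16\<close> at \<open>-1, 0, 1\<close> have variance \<open>1/8\<close>, and
  \<open>l = 4\<close> violates the bound, since \<open>7/8 + cosh 4 / 8 > e\<close>.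

  For the second half, expanding \<open>ln E exp (l (X - \<mu>)) - l\<^sup>2 Var X / 2\<close> at \<open>l = 0\<close> shows that the
  third central moment has to vanish and the fourth cumulant must not be positive. Three atoms
  \<open>-2, 1, 3\<close> with masses \<open>2/5, 1/2, 1/10\<close> meet this without symmetry: the mean and the third
  moment are \<open>0\<close>, the variance is \<open>3\<close> and the fourth cumulant is \<open>15 - 27 < 0\<close>. That the bound
  holds for every \<open>l\<close>, and not only near \<open>0\<close>, follows from the fact that the second derivative of
  the cumulant generating function, which is the variance of the exponentially tilted law, never
  exceeds its value \<open>3\<close> at \<open>l = 0\<close> (\<open>tilted_variance_skewless\<close>).
\<close>

section \<open>The optimal proxy variance is an attained minimum\<close>

text \<open>Averaging the exponential over \<open>y\<close> and \<open>- y\<close> removes the odd terms, so that the quadratic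
  Taylor polynomial is a global lower bound; integrated, it turns bounds on the moment generating
  function into bounds on the second moment.\<close>

lemma exp_plus_exp_minus_ge:
  fixes y :: real
  shows "2 + y\<^sup>2 \<le> exp y + exp (- y)"
proof -
  let ?f = "\<lambda>y::real. exp y + exp (- y) - y\<^sup>2"
  have "?f y - ?f 0 \<ge> (exp 0 - exp (- 0) - 2 * 0) * (y - 0)"
  proof (rule f''_imp_f'[where C = UNIV and f'' = "\<lambda>y. exp y + exp (- y) - 2"])
    show "(?f has_real_derivative exp x - exp (- x) - 2 * x) (at x)" for x :: real
      by (auto intro!: derivative_eq_intros)
    show "((\<lambda>x. exp x - exp (- x) - 2 * x) has_real_derivative exp x + exp (- x) - 2) (at x)"
      for x :: real
      by (auto intro!: derivative_eq_intros)
    show "0 \<le> exp x + exp (- x) - 2" for x :: real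
      using cosh_real_ge_1[of x] by (simp add: cosh_def)
  qed auto
  then show ?thesis by simp
qed

context prob_space
begin

lemma sub_gaussian_integrable_square:
  assumes "sub_gaussian X s"
  shows "integrable M (\<lambda>x. (X x - expectation X)\<^sup>2)"
proof (rule Bochner_Integration.integrable_bound)
  have int: "integrable M (\<lambda>x. exp (l * (X x - expectation X)))" for l
    using assms by (simp add: sub_gaussian_def)
  show "integrable M (\<lambda>x. exp (X x - expectation X) + exp (- (X x - expectation X)))"
    using int[of 1] int[of "-1"] by auto
  show "(\<lambda>x. (X x - expectation X)\<^sup>2) \<in> borel_measurable M"
    using assms by (auto simp: sub_gaussian_def)
  show "AE x in M. norm ((X x - expectation X)\<^sup>2)
          \<le> norm (exp (X x - expectation X) + exp (- (X x - expectation X)))"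
  proof (rule AE_I2)
    fix x
    show "norm ((X x - expectation X)\<^sup>2)
          \<le> norm (exp (X x - expectation X) + exp (- (X x - expectation X)))"
      using exp_plus_exp_minus_ge[of "X x - expectation X"] by simp
  qed
qed

text \<open>Adding the bounds for \<open>l\<close> and \<open>- l\<close> gives \<open>1 + l\<^sup>2 Var X / 2 \<le> exp (l\<^sup>2 s / 2)\<close>, and the
  right-hand side is \<open>1 + l\<^sup>2 s / 2 + O(l\<^sup>4)\<close>. Dividing by \<open>l\<^sup>2\<close> and letting \<open>l \<rightarrow> 0\<close> yields the
  claim; below, \<open>t\<close> plays the role of \<open>l\<^sup>2\<close>.\<close>

lemma variance_le_proxy:
  assumes sg: "sub_gaussian X s"
  shows "variance X \<le> s"
proof (rule field_le_epsilon)
  let ?Y = "\<lambda>x. X x - expectation X"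
  have s: "s > 0"
    and int: "\<And>l. integrable M (\<lambda>x. exp (l * ?Y x))"
    and mgf: "\<And>l. expectation (\<lambda>x. exp (l * ?Y x)) \<le> exp (l\<^sup>2 * s / 2)"
    using sg by (auto simp: sub_gaussian_def)
  have quad: "1 + t * variance X / 2 \<le> exp (t * s / 2)" if t: "t > 0" for t
  proof -
    define l where "l = sqrt t"
    have l: "l\<^sup>2 = t" using t by (simp add: l_def)
    have "2 + t * variance X = expectation (\<lambda>x. 2 + t * (?Y x)\<^sup>2)"
      using sub_gaussian_integrable_square[OF sg] by (simp add: prob_space)
    also have "\<dots> \<le> expectation (\<lambda>x. exp (l * ?Y x) + exp ((- l) * ?Y x))"
    proof (rule integral_mono)
      show "integrable M (\<lambda>x. 2 + t * (?Y x)\<^sup>2)"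
        using sub_gaussian_integrable_square[OF sg] by simp
      show "integrable M (\<lambda>x. exp (l * ?Y x) + exp ((- l) * ?Y x))"
        by (intro Bochner_Integration.integrable_add int)
      show "2 + t * (?Y x)\<^sup>2 \<le> exp (l * ?Y x) + exp ((- l) * ?Y x)" for x
        using exp_plus_exp_minus_ge[of "l * ?Y x"] by (simp add: power_mult_distrib l)
    qed
    also have "\<dots> \<le> 2 * exp (t * s / 2)"
      using mgf[of l] mgf[of "- l"] int[of l] int[of "- l"]
      by (subst Bochner_Integration.integral_add) (auto simp: l)
    finally show ?thesis by simp
  qed
  fix e :: real assume e: "e > 0"
  \<comment> \<open>The first argument makes the quadratic bound on \<open>exp\<close> valid at \<open>t * s / 2\<close>, the second
    makes its error term, after division by \<open>t / 2\<close>, at most \<open>e\<close>.\<close>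
  define t where "t = min (2 / s) (2 * e / s\<^sup>2)"
  have t: "t > 0" using s e by (simp add: t_def)
  have ts: "t * s / 2 \<le> 1" 
    using mult_right_mono[of t "2 / s" s] s by (simp add: t_def)
  have te: "t * s\<^sup>2 / 2 \<le> e"
    using mult_right_mono[of t "2 * e / s\<^sup>2" "s\<^sup>2"] s by (simp add: t_def)
  have "1 + t * variance X / 2 \<le> 1 + t * s / 2 + (t * s / 2)\<^sup>2"
    using quad[OF t] exp_bound[of "t * s / 2"] t s ts by simp
  then have "t / 2 * variance X \<le> t / 2 * (s + t * s\<^sup>2 / 2)"
    by (simp add: algebra_simps power2_eq_square)
  then have "variance X \<le> s + t * s\<^sup>2 / 2"
    using t by (simp add: mult_le_cancel_left_pos)
  then show "variance X \<le> s + e" using te by simp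
qed

lemma variance_pos:
  assumes "nondegenerate X" and sq: "integrable M (\<lambda>x. (X x - expectation X)\<^sup>2)"
  shows "variance X > 0"
proof (rule ccontr)
  assume "\<not> variance X > 0"
  moreover have "variance X \<ge> 0" by simp
  ultimately have "variance X = 0" by linarith
  then have "AE x in M. (X x - expectation X)\<^sup>2 = 0"
    using integral_nonneg_eq_0_iff_AE[OF sq] by simp
  then have "AE x in M. X x = expectation X" by simp
  with assms show False by (auto simp: nondegenerate_def)
qed

text \<open>The description of \<open>optimal_proxy_variance\<close> as a least element carries information only if
  the minimum is attained, so the point of the forward direction is that the infimum of all proxy
  variances is again one: for \<open>l \<noteq> 0\<close> the defining bound amounts to a lower bound on \<open>s\<close>, which
  passes to the infimum. Non-degeneracy keeps that infimum positive.\<close>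

lemma strictly_sub_gaussian_iff:
  assumes nd: "nondegenerate X"
  shows "strictly_sub_gaussian X \<longleftrightarrow> sub_gaussian X (variance X)"
proof
  assume sg: "sub_gaussian X (variance X)"
  then have "optimal_proxy_variance X = variance X"
    unfolding optimal_proxy_variance_def by (intro Least_equality variance_le_proxy)
  with sg show "strictly_sub_gaussian X" by (auto simp: strictly_sub_gaussian_def)
next
  let ?S = "{s. sub_gaussian X s}"
  let ?E = "\<lambda>l. expectation (\<lambda>x. exp (l * (X x - expectation X)))"
  assume strict: "strictly_sub_gaussian X"
  then obtain s0 where s0: "sub_gaussian X s0" by (auto simp: strictly_sub_gaussian_def)
  have ge: "variance X \<le> Inf ?S"
    using s0 variance_le_proxy by (intro cInf_greatest) auto
  have "variance X > 0"
    by (rule variance_pos[OF nd sub_gaussian_integrable_square[OF s0]])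
  have "?E l \<le> exp (l\<^sup>2 * Inf ?S / 2)" for l
  proof (cases "l = 0 \<or> ?E l \<le> 0")
    case True
    then show ?thesis
      by (auto simp: prob_space intro: order.trans[OF _ exp_ge_zero])
  next
    case False
    then have l: "l\<^sup>2 > 0" and E: "?E l > 0" by auto
    have "2 * ln (?E l) / l\<^sup>2 \<le> Inf ?S"
    proof (rule cInf_greatest)
      show "?S \<noteq> {}" using s0 by auto
      fix s assume "s \<in> ?S"
      then have "?E l \<le> exp (l\<^sup>2 * s / 2)" by (simp add: sub_gaussian_def)
      then have "ln (?E l) \<le> l\<^sup>2 * s / 2" 
        using E by (metis exp_gt_zero ln_exp ln_le_cancel_iff)
      then show "2 * ln (?E l) / l\<^sup>2 \<le> s" using l by (simp add: field_simps)
    qed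
    then have "ln (?E l) \<le> l\<^sup>2 * Inf ?S / 2" using l by (simp add: field_simps)
    then show ?thesis using E by (metis exp_le_cancel_iff exp_ln)
  qed
  then have "sub_gaussian X (Inf ?S)"
    using s0 ge \<open>variance X > 0\<close> by (simp add: sub_gaussian_def)
  moreover have "Inf ?S \<le> s" if "sub_gaussian X s" for s
    using that by (intro cInf_lower bdd_belowI[of _ "variance X"]) (auto intro: variance_le_proxy)
  ultimately have "sub_gaussian X (LEAST s. sub_gaussian X s)"
    by (rule LeastI2_order)
  with strict show "sub_gaussian X (variance X)"
    by (simp add: strictly_sub_gaussian_def optimal_proxy_variance_def)
qed

end


section \<open>A symmetric law that is not strictly sub-Gaussian\<close>

definition peaked_pmf :: "real pmf" where
  "peaked_pmf = pmf_of_list [(-1, 1/16), (0, 7/8), (1, 1/16)]"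

lemma pmf_peaked:
  "pmf peaked_pmf x = (if x = -1 then 1/16 else if x = 0 then 7/8 else if x = 1 then 1/16 else 0)"
  unfolding peaked_pmf_def by (subst pmf_pmf_of_list) (auto simp: pmf_of_list_wf_def)

lemma set_peaked: "set_pmf peaked_pmf = {-1, 0, 1}"
  by (auto simp: set_pmf_eq pmf_peaked)

lemma expectation_peaked:
  fixes f :: "real \<Rightarrow> real"
  shows "measure_pmf.expectation peaked_pmf f = (f (-1) + 14 * f 0 + f 1) / 16"
  by (subst integral_measure_pmf_real[where A = "{-1, 0, 1}"])
     (auto simp: set_peaked pmf_peaked add_divide_distrib)

lemma symmetric_peaked: "map_pmf uminus peaked_pmf = peaked_pmf"
proof (rule pmf_eqI)
  fix x :: real
  have "pmf (map_pmf uminus peaked_pmf) (- (- x)) = pmf peaked_pmf (- x)"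
    by (rule pmf_map_inj') (simp add: inj_def)
  then show "pmf (map_pmf uminus peaked_pmf) x = pmf peaked_pmf x"
    by (auto simp: pmf_peaked)
qed

lemma distr_measure_pmf_borel:
  fixes f :: "'a \<Rightarrow> 'b :: topological_space"
  shows "distr (measure_pmf p) borel f = distr (measure_pmf (map_pmf f p)) borel (\<lambda>x. x)"
  by (rule measure_eqI) (auto simp: emeasure_distr)

lemma nondegenerate_pmfI:
  assumes "x \<in> set_pmf p" "y \<in> set_pmf p" "X x \<noteq> X y"
  shows "prob_space.nondegenerate (measure_pmf p) X"
  unfolding measure_pmf.nondegenerate_def AE_measure_pmf_iff using assms by metis

lemma as_bounded_pmfI:
  assumes "finite (set_pmf p)"
  shows "prob_space.as_bounded (measure_pmf p) X"
  unfolding measure_pmf.as_bounded_def AE_measure_pmf_iff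
  using finite_imp_bounded[OF finite_imageI[OF assms, of X]] by (auto simp: bounded_iff)

text \<open>The coarse estimates \<open>5/2 \<le> e \<le> 3\<close> already refute the bound at \<open>l = 4\<close>, where it reads
  \<open>(exp (-4) + 14 + exp 4) / 16 \<le> e\<close>: the left-hand side exceeds \<open>(14 + 39) / 16 > 3\<close>.\<close>

lemma not_strictly_sub_gaussian_peaked:
  "\<not> prob_space.strictly_sub_gaussian (measure_pmf peaked_pmf) (\<lambda>x. x)"
proof
  assume "prob_space.strictly_sub_gaussian (measure_pmf peaked_pmf) (\<lambda>x. x)"
  then have "measure_pmf.sub_gaussian peaked_pmf (\<lambda>x. x)
      (measure_pmf.variance peaked_pmf (\<lambda>x. x))"
    by (subst (asm) measure_pmf.strictly_sub_gaussian_iff)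
       (auto intro: nondegenerate_pmfI[of 0 _ 1] simp: set_peaked)
  then have "(exp (-4) + 14 + exp 4) / 16 \<le> exp (4\<^sup>2 * (1/8) / 2 :: real)"
    unfolding measure_pmf.sub_gaussian_def by (auto simp: expectation_peaked dest!: spec[of _ 4])
  then have le: "exp (-4) + 14 + exp 4 \<le> 16 * exp (1::real)" by simp
  have "exp (4::real) = exp 1 ^ 4" by (simp flip: exp_of_nat_mult)
  moreover have "(5/2) ^ 4 \<le> exp (1::real) ^ 4"
    using exp_lower_Taylor_quadratic[of "1::real"] by (intro power_mono) auto
  ultimately have "39 \<le> exp (4::real)" by (simp add: power_divide)
  then show False using le exp_le exp_gt_zero[of "-4::real"] by linarith
qed


section \<open>An asymmetric law that is strictly sub-Gaussian\<close>

text \<open>Up to a factor, the masses \<open>(4, 5, 1)\<close> are the only solution of the two linear equations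
  that make the first and the third moment on the atoms \<open>-2, 1, 3\<close> vanish.\<close>

definition skewless_pmf :: "real pmf" where
  "skewless_pmf = pmf_of_list [(-2, 2/5), (1, 1/2), (3, 1/10)]"

lemma pmf_skewless:
  "pmf skewless_pmf x = (if x = -2 then 2/5 else if x = 1 then 1/2 else if x = 3 then 1/10 else 0)"
  unfolding skewless_pmf_def by (subst pmf_pmf_of_list) (auto simp: pmf_of_list_wf_def)

lemma set_skewless: "set_pmf skewless_pmf = {-2, 1, 3}"
  by (auto simp: set_pmf_eq pmf_skewless)

lemma expectation_skewless:
  fixes f :: "real \<Rightarrow> real"
  shows "measure_pmf.expectation skewless_pmf f = (4 * f (-2) + 5 * f 1 + f 3) / 10"
  by (subst integral_measure_pmf_real[where A = "{-2, 1, 3}"])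
     (auto simp: set_skewless pmf_skewless add_divide_distrib)

text \<open>With \<open>x = exp l\<close>, the tilted law gives the atoms \<open>-2, 1, 3\<close> weights proportional to
  \<open>4, 5 x\<^sup>3, x\<^sup>5\<close>; its variance is \<open>m2 / m0 - (m1 / m0)\<^sup>2\<close>, and the claim is that this is at
  most \<open>3\<close>. Equality holds at \<open>x = 1\<close>, where the tilt is trivial, and because the third cumulant
  vanishes the difference of the two sides has a double root there. The cofactor of
  \<open>(x - 1)\<^sup>2\<close> turns out to have only positive coefficients.\<close>

lemma tilted_variance_skewless:
  fixes x :: real
  assumes x: "x > 0"
  defines "m0 \<equiv> 4 + 5 * x^3 + x^5"
    and "m1 \<equiv> - 8 + 5 * x^3 + 3 * x^5"
    and "m2 \<equiv> 16 + 5 * x^3 + 9 * x^5"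
  shows "m2 * m0 - m1\<^sup>2 \<le> 3 * m0\<^sup>2"
proof -
  let ?Q = "48 + 96*x + 144*x^2 + 132*x^3 + 120*x^4 + 32*x^5 + 19*x^6 + 6*x^7 + 3*x^8"
  have "3 * m0\<^sup>2 - (m2 * m0 - m1\<^sup>2) = (x - 1)\<^sup>2 * ?Q"
    unfolding m0_def m1_def m2_def by algebra
  moreover have "?Q \<ge> 0" using x by (intro add_nonneg_nonneg) auto
  ultimately show ?thesis by (smt (verit) zero_le_mult_iff zero_le_power2)
qed

text \<open>The left-hand side is \<open>m0 l / 10\<close>, with \<open>m1\<close> and \<open>m2\<close> its rescaled first and second
  derivatives. The function \<open>3 l\<^sup>2 / 2 - ln (m0 l)\<close> has second derivative \<open>3\<close> minus the tilted
  variance, hence is convex; its tangent at \<open>0\<close> is horizontal since the mean is \<open>0\<close>, so the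
  function is minimal there.\<close>

lemma mgf_skewless_le:
  fixes l :: real
  shows "(4 * exp (- 2 * l) + 5 * exp l + exp (3 * l)) / 10 \<le> exp (3 * l\<^sup>2 / 2)"
proof -
  define m0 where "m0 = (\<lambda>l::real. 4 * exp (- 2 * l) + 5 * exp l + exp (3 * l))"
  define m1 where "m1 = (\<lambda>l::real. - 8 * exp (- 2 * l) + 5 * exp l + 3 * exp (3 * l))"
  define m2 where "m2 = (\<lambda>l::real. 16 * exp (- 2 * l) + 5 * exp l + 9 * exp (3 * l))"
  have pos: "m0 l > 0" for l by (auto simp: m0_def intro!: add_pos_pos)
  have d0: "(m0 has_real_derivative m1 l) (at l)" for l
    unfolding m0_def m1_def by (auto intro!: derivative_eq_intros)
  have d1: "(m1 has_real_derivative m2 l) (at l)" for l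
    unfolding m1_def m2_def by (auto intro!: derivative_eq_intros)
  have var: "m2 l * m0 l - m1 l * m1 l \<le> 3 * (m0 l * m0 l)" for l
  proof -
    define x where "x = exp l"
    have x: "x > 0" by (simp add: x_def)
    have e: "exp (- 2 * l) = 1 / x^2" "exp (3 * l) = x^3" "exp l = x"
      by (simp_all add: x_def exp_minus field_simps flip: exp_of_nat_mult exp_add)
    have "m0 l = (4 + 5 * x^3 + x^5) / x^2" "m1 l = (- 8 + 5 * x^3 + 3 * x^5) / x^2"
      "m2 l = (16 + 5 * x^3 + 9 * x^5) / x^2"
      unfolding m0_def m1_def m2_def e using x by (auto simp: field_simps eval_nat_numeral)
    then show ?thesis
      using divide_right_mono[OF tilted_variance_skewless[OF x], of "x^2 * x^2"]
      by (simp add: power2_eq_square diff_divide_distrib)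
  qed
  let ?F = "\<lambda>l. 3 * l\<^sup>2 / 2 - ln (m0 l)"
  have "?F l - ?F 0 \<ge> (3 * 0 - m1 0 / m0 0) * (l - 0)"
  proof (rule f''_imp_f'[where C = UNIV
        and f'' = "\<lambda>l. 3 - (m2 l * m0 l - m1 l * m1 l) / (m0 l * m0 l)"])
    show "(?F has_real_derivative 3 * l - m1 l / m0 l) (at l)" for l
      using pos[of l] by (auto intro!: derivative_eq_intros d0)
    show "((\<lambda>l. 3 * l - m1 l / m0 l) has_real_derivative
            3 - (m2 l * m0 l - m1 l * m1 l) / (m0 l * m0 l)) (at l)" for l
      using pos[of l] by (auto intro!: derivative_eq_intros d0 d1)
    show "0 \<le> 3 - (m2 l * m0 l - m1 l * m1 l) / (m0 l * m0 l)" for l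
      using var[of l] pos[of l] by (simp add: divide_le_eq)
  qed auto
  then have "ln (m0 l / 10) \<le> 3 * l\<^sup>2 / 2"
    using pos[of l] by (simp add: m1_def m0_def[THEN fun_cong, of 0] ln_div)
  then have "m0 l / 10 \<le> exp (3 * l\<^sup>2 / 2)"
    using pos[of l] by (metis exp_le_cancel_iff exp_ln divide_pos_pos zero_less_numeral)
  then show ?thesis by (simp add: m0_def)
qed

lemma strictly_sub_gaussian_skewless:
  "prob_space.strictly_sub_gaussian (measure_pmf skewless_pmf) (\<lambda>x. x)"
proof -
  have "measure_pmf.sub_gaussian skewless_pmf (\<lambda>x. x)
      (measure_pmf.variance skewless_pmf (\<lambda>x. x))"
    unfolding measure_pmf.sub_gaussian_def
    using mgf_skewless_le
    by (auto simp: expectation_skewless set_skewless mult.commute intro!: integrable_measure_pmf_finite)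
  then show ?thesis
    by (subst measure_pmf.strictly_sub_gaussian_iff)
       (auto intro: nondegenerate_pmfI[of 1 _ 3] simp: set_skewless)
qed

lemma not_symmetric_skewless:
  "\<not> prob_space.symmetric_rv (measure_pmf skewless_pmf) (\<lambda>x. x)"
proof
  assume "prob_space.symmetric_rv (measure_pmf skewless_pmf) (\<lambda>x. x)"
  then have eq: "distr skewless_pmf borel (\<lambda>x. x) = distr skewless_pmf borel (\<lambda>x. - x)"
    by (simp add: measure_pmf.symmetric_rv_def expectation_skewless)
  have "measure (distr skewless_pmf borel (\<lambda>x. x)) {-2} = pmf skewless_pmf (-2)"
    by (subst measure_distr) (auto simp: measure_pmf_single)
  moreover have "measure (distr skewless_pmf borel (\<lambda>x. - x)) {-2} = pmf skewless_pmf 2"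
  proof -
    have "uminus -` {-2} = {2::real}" by auto
    then show ?thesis by (subst measure_distr) (auto simp: measure_pmf_single)
  qed
  \<comment> \<open>The atom at \<open>-2\<close> has no mirror image at \<open>2\<close>.\<close>
  ultimately show False using eq by (simp add: pmf_skewless)
qed

section \<open>Independence of symmetry and strict sub-Gaussianity\<close>

theorem proposition1p2:
  shows "(\<exists>(M :: real measure) (X :: real \<Rightarrow> real).
            prob_space M \<and> X \<in> borel_measurable M \<and>
            prob_space.nondegenerate M X \<and> prob_space.as_bounded M X \<and>
            prob_space.symmetric_rv M X \<and> \<not> prob_space.strictly_sub_gaussian M X)
       \<and> (\<exists>(M :: real measure) (X :: real \<Rightarrow> real).
            prob_space M \<and> X \<in> borel_measurable M \<and>
            prob_space.nondegenerate M X \<and> prob_space.as_bounded M X \<and>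
            prob_space.strictly_sub_gaussian M X \<and> \<not> prob_space.symmetric_rv M X)"
proof (intro conjI exI)
  show "prob_space.symmetric_rv (measure_pmf peaked_pmf) (\<lambda>x. x)"
    using distr_measure_pmf_borel[of peaked_pmf uminus]
    by (simp add: measure_pmf.symmetric_rv_def expectation_peaked symmetric_peaked)
  show "prob_space.nondegenerate (measure_pmf peaked_pmf) (\<lambda>x. x)"
    by (rule nondegenerate_pmfI[of 0 _ 1]) (auto simp: set_peaked)
  show "prob_space.nondegenerate (measure_pmf skewless_pmf) (\<lambda>x. x)"
    by (rule nondegenerate_pmfI[of 1 _ 3]) (auto simp: set_skewless)
qed (auto simp: prob_space_measure_pmf set_peaked set_skewless
      intro!: as_bounded_pmfI not_strictly_sub_gaussian_peaked
        strictly_sub_gaussian_skewless not_symmetric_skewless)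

end
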